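(* If $k\geq 3$, then $\mathrm{sat}_k(n,\text{Berge-}K_{1,k+1})=n-k+1$ for all $n\geq k^2$.
   Context: Hypergraphs are finite and have no repeated edges; a hypergraph is $k$-uniform if every edge has exactly $k$ vertices. $K_{1,t}$ is the star graph with $t$ edges. For a graph $F$, a hypergraph $B$ is a Berge-$F$ if (with $V(F)$ identified with distinct vertices of $B$) there is a bijection $\phi:E(F)\to E(B)$ with $e\subseteq\phi(e)$ for all $e\in E(F)$. A hypergraph contains a Berge-$F$ if some subhypergraph of it is a Berge-$F$. A $k$-uniform hypergraph $H$ is Berge-$F$-saturated if $H$ contains no Berge-$F$, but for every $k$-subset $e$ of $V(H)$ with $e\notin E(H)$ the hypergraph $H+e$ contains a Berge-$F$. $\mathrm{sat}_k(n,\text{Berge-}F)$ is the minimum number of edges of a $k$-uniform Berge-$F$-saturated hypergraph on $n$ vertices. *)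

theory Defs
  imports Complex_Main "HOL-Library.Extended_Nat"
begin

record 'a hypergraph =
  verts :: "'a set"
  edges :: "'a set set"

definition hypergraph :: "'a hypergraph \<Rightarrow> bool" where
  "hypergraph H \<longleftrightarrow> finite (verts H) \<and> (\<forall>e\<in>edges H. e \<subseteq> verts H)"

definition uniform :: "nat \<Rightarrow> 'a hypergraph \<Rightarrow> bool" where
  "uniform k H \<longleftrightarrow> (\<forall>e\<in>edges H. card e = k)"

definition subhypergraph :: "'a hypergraph \<Rightarrow> 'a hypergraph \<Rightarrow> bool" where
  "subhypergraph B H \<longleftrightarrow> hypergraph B \<and> verts B \<subseteq> verts H \<and> edges B \<subseteq> edges H"

definition add_edge :: "'a hypergraph \<Rightarrow> 'a set \<Rightarrow> 'a hypergraph" where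
  "add_edge H e = H\<lparr>edges := insert e (edges H)\<rparr>"

text \<open>A graph is a 2-uniform hypergraph. The star has centre 0 and leaves 1, ..., t.\<close>

definition star :: "nat \<Rightarrow> nat hypergraph" where
  "star t = \<lparr>verts = {0..t}, edges = {{0, i} | i. i \<in> {1..t}}\<rparr>"

text \<open>The injection \<open>f\<close> is the identification of the vertices of \<open>F\<close> with distinct vertices of \<open>B\<close>.\<close>

definition is_Berge :: "'b hypergraph \<Rightarrow> 'a hypergraph \<Rightarrow> bool" where
  "is_Berge F B \<longleftrightarrow>
     (\<exists>f \<phi>. inj_on f (verts F) \<and> f ` verts F \<subseteq> verts B \<and>
        bij_betw \<phi> (edges F) (edges B) \<and> (\<forall>e\<in>edges F. f ` e \<subseteq> \<phi> e))"

definition contains_Berge :: "'b hypergraph \<Rightarrow> 'a hypergraph \<Rightarrow> bool" where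
  "contains_Berge F H \<longleftrightarrow> (\<exists>B. subhypergraph B H \<and> is_Berge F B)"

definition Berge_saturated :: "nat \<Rightarrow> 'b hypergraph \<Rightarrow> 'a hypergraph \<Rightarrow> bool" where
  "Berge_saturated k F H \<longleftrightarrow>
     hypergraph H \<and> uniform k H \<and> \<not> contains_Berge F H \<and>
     (\<forall>e. e \<subseteq> verts H \<and> card e = k \<and> e \<notin> edges H \<longrightarrow> contains_Berge F (add_edge H e))"

text \<open>
  Vertices are natural numbers, which loses no generality since every finite hypergraph is
  isomorphic to such a one. The infimum is taken in \<open>enat\<close>, so that it is \<open>\<infinity>\<close> if there is no
  saturated hypergraph on \<open>n\<close> vertices, and a finite value is always an attained minimum.
\<close>

definition sat :: "nat \<Rightarrow> nat \<Rightarrow> 'b hypergraph \<Rightarrow> enat" where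
  "sat k n F = Inf {enat (card (edges H)) | H :: nat hypergraph.
                      card (verts H) = n \<and> Berge_saturated k F H}"

end

theory Submission
  imports Defs
begin

text \<open>
  A family of at most \<open>k + 1\<close> distinct sets of size \<open>k - 1 \<ge> 1\<close> always has at least as many
  points as members, because a ground set of \<open>k - 1\<close> or \<open>k\<close> points has only \<open>1\<close> or \<open>k\<close> such subsets.
  Applied to the edges through a vertex, with that vertex deleted, Hall's theorem therefore
  supplies distinct leaves as soon as there are \<open>k + 1\<close> edges. So containing a Berge-\<open>K\<^bsub>1,k+1\<^esub>\<close>
  just means having a vertex of degree at least \<open>k + 1\<close>
  (\<open>contains_Berge_star_iff\<close>), and saturation becomes a statement about degrees: all degrees
  are at most \<open>k\<close>, and every \<open>k\<close>-set of vertices of degree less than \<open>k\<close> is an edge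
  (\<open>Berge_saturated_star_iff\<close>).

  For the lower bound, let \<open>L\<close> be the set of vertices of degree less than \<open>k\<close>. If \<open>L\<close> had more
  than \<open>k\<close> points, then the \<open>k\<close>-subsets of \<open>k + 1\<close> of them would already give each of these
  points degree \<open>k\<close>. If \<open>L\<close> has exactly \<open>k\<close> points, it is an edge, and so its points have degree at
  least 1. In every case the degree sum, which is \<open>k\<close> times the number of edges, is at least
  \<open>k * (n - k + 1)\<close>.

  Equality is attained by \<open>k - 1\<close> isolated vertices together with the cyclic intervals of length
  \<open>k\<close> on the other \<open>m = n - k + 1\<close> vertices: these are \<open>m\<close> edges forming a \<open>k\<close>-regular
  hypergraph, and every \<open>k\<close>-set of vertices meets its vertex set.
\<close>

section \<open>Hall's marriage theorem\<close>

text \<open>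
  The induction of Halmos and Vaughan. If every proper nonempty subfamily has a point to spare, any
  choice for one member may be removed from all the others. Otherwise a tight proper subfamily \<open>J\<close>
  can be served on its own, and after deleting its points the remaining members still satisfy
  the condition, since a violation by \<open>K\<close> would be one by \<open>J \<union> K\<close> in the original family.
\<close>

theorem Hall_marriage:
  fixes A :: "'i \<Rightarrow> 'a set"
  assumes "finite I" and "\<And>i. i \<in> I \<Longrightarrow> finite (A i)"
    and "\<And>J. J \<subseteq> I \<Longrightarrow> card J \<le> card (\<Union>(A ` J))"
  shows "\<exists>f. inj_on f I \<and> (\<forall>i\<in>I. f i \<in> A i)"
  using assms
proof (induction "card I" arbitrary: I A rule: less_induct)
  case less
  note fin = less.prems(1) and finA = less.prems(2) and hall = less.prems(3)
  show ?case
  proof (cases "\<exists>J. J \<subset> I \<and> J \<noteq> {} \<and> card (\<Union>(A ` J)) = card J")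
    case True
    then obtain J where J: "J \<subset> I" "J \<noteq> {}" and tight: "card (\<Union>(A ` J)) = card J" by blast
    define U where "U = \<Union>(A ` J)"
    have finJ: "finite J" using J fin finite_subset by blast
    have "card J < card I" using J fin by (simp add: psubset_card_mono)
    then have "\<exists>f. inj_on f J \<and> (\<forall>i\<in>J. f i \<in> A i)"
    proof (rule less.hyps)
      show "finite J" by fact
      show "finite (A i)" if "i \<in> J" for i using that J finA by blast
      show "card K \<le> card (\<Union>(A ` K))" if "K \<subseteq> J" for K
        using that J by (intro hall) blast
    qed
    then obtain f where f: "inj_on f J" "\<forall>i\<in>J. f i \<in> A i" by blast
    have "\<exists>g. inj_on g (I - J) \<and> (\<forall>i\<in>I - J. g i \<in> A i - U)"
    proof (rule less.hyps)
      show "card (I - J) < card I"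
        using J fin by (intro psubset_card_mono) auto
      show "finite (I - J)" using fin by simp
      show "finite (A i - U)" if "i \<in> I - J" for i using that finA by simp
      fix K assume K: "K \<subseteq> I - J"
      have finK: "finite K" using K fin finite_subset by blast
      have "card J + card K = card (J \<union> K)"
        using K finJ finK by (intro card_Un_disjoint [symmetric]) auto
      also have "\<dots> \<le> card (\<Union>(A ` (J \<union> K)))"
        using J K by (intro hall) auto
      also have "\<Union>(A ` (J \<union> K)) = U \<union> (\<Union>i\<in>K. A i - U)"
        by (auto simp: U_def)
      also have "card \<dots> \<le> card U + card (\<Union>i\<in>K. A i - U)"
        by (rule card_Un_le)
      finally show "card K \<le> card (\<Union>i\<in>K. A i - U)"
        using tight by (simp add: U_def)
    qed
    then obtain g where g: "inj_on g (I - J)" "\<forall>i\<in>I - J. g i \<in> A i - U" by blast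
    have fU: "f i \<in> U" if "i \<in> J" for i
      using that f by (auto simp: U_def)
    let ?h = "\<lambda>i. if i \<in> J then f i else g i"
    have "inj_on ?h (J \<union> (I - J))"
    proof (rule inj_on_disjoint_Un)
      have "f ` J \<subseteq> U" "g ` (I - J) \<inter> U = {}" using fU g(2) by auto
      then show "f ` J \<inter> g ` (I - J) = {}" by blast
    qed (fact f(1) g(1))+
    then have "inj_on ?h I" using J by (simp add: Un_absorb1 psubset_imp_subset)
    moreover have "\<forall>i\<in>I. ?h i \<in> A i" using f g by auto
    ultimately show ?thesis by blast
  next
    case False
    have slack: "card J < card (\<Union>(A ` J))" if "J \<subset> I" "J \<noteq> {}" for J
    proof -
      have "card J \<le> card (\<Union>(A ` J))" using that by (intro hall) blast
      moreover have "card (\<Union>(A ` J)) \<noteq> card J" using False that by blast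
      ultimately show ?thesis by simp
    qed
    show ?thesis
    proof (cases "I = {}")
      case True
      then show ?thesis by simp
    next
      case False
      then obtain i where i: "i \<in> I" by blast
      have "A i \<noteq> {}" using hall[of "{i}"] i by auto
      then obtain x where x: "x \<in> A i" by blast
      have "\<exists>g. inj_on g (I - {i}) \<and> (\<forall>j\<in>I - {i}. g j \<in> A j - {x})"
      proof (rule less.hyps)
        show "card (I - {i}) < card I" using i fin by (intro card_Diff1_less)
        show "finite (I - {i})" using fin by simp
        show "finite (A j - {x})" if "j \<in> I - {i}" for j using that finA by simp
        fix K assume K: "K \<subseteq> I - {i}"
        show "card K \<le> card (\<Union>j\<in>K. A j - {x})"
        proof (cases "K = {}")
          case False
          have "card K < card (\<Union>(A ` K))" using slack[of K] K False i by blast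
          also have "\<dots> \<le> Suc (card (\<Union>(A ` K) - {x}))"
            using diff_card_le_card_Diff[of "{x}" "\<Union>(A ` K)"] by simp
          also have "\<Union>(A ` K) - {x} = (\<Union>j\<in>K. A j - {x})" by blast
          finally show ?thesis by simp
        qed simp
      qed
      then obtain g where g: "inj_on g (I - {i})" "\<forall>j\<in>I - {i}. g j \<in> A j - {x}" by blast
      let ?h = "g(i := x)"
      have "inj_on ?h I"
        using g by (auto simp: inj_on_def)
      moreover have "\<forall>j\<in>I. ?h j \<in> A j" using g x by auto
      ultimately show ?thesis by blast
    qed
  qed
qed

text \<open>
  Few points carry few sets: \<open>r\<close> points have one subset of size \<open>r\<close>, and \<open>r + 1\<close> points have
  \<open>r + 1\<close>. The bound \<open>r + 2\<close> is where this stops, as \<open>r + 2\<close> points have more than \<open>r + 2\<close>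
  subsets of size \<open>r\<close> once \<open>r > 1\<close>.
\<close>

lemma card_le_card_Union_uniform:
  assumes "finite J" and "\<And>S. S \<in> J \<Longrightarrow> finite S" and unif: "\<And>S. S \<in> J \<Longrightarrow> card S = r"
    and "r \<ge> 1" and "card J \<le> r + 2"
  shows "card J \<le> card (\<Union>J)"
proof (cases "J = {}")
  case False
  have finU: "finite (\<Union>J)" using assms(1,2) by (rule finite_Union)
  obtain S where "S \<in> J" using False by blast
  then have "r \<le> card (\<Union>J)" using unif card_mono[OF finU Union_upper] by simp
  have "card J \<le> card {S. S \<subseteq> \<Union>J \<and> card S = r}"
    using finU unif by (intro card_mono) auto
  then have bound: "card J \<le> card (\<Union>J) choose r"
    using finU by (simp add: n_subsets)
  consider "card (\<Union>J) = r" | "card (\<Union>J) = Suc r" | "card (\<Union>J) \<ge> r + 2"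
    using \<open>r \<le> card (\<Union>J)\<close> by linarith
  then show ?thesis
    using bound assms(4,5) by cases simp_all
qed simp

section \<open>Berge stars and degrees\<close>

definition degree :: "'a hypergraph \<Rightarrow> 'a \<Rightarrow> nat" where
  "degree H v = card {e \<in> edges H. v \<in> e}"

lemma finite_edges: "hypergraph H \<Longrightarrow> finite (edges H)"
  by (rule finite_subset[of _ "Pow (verts H)"]) (auto simp: hypergraph_def)

lemma bij_betw_star_edges: "bij_betw (\<lambda>i. {0, i}) {1..t} (edges (star t))"
  by (auto simp: bij_betw_def inj_on_def star_def doubleton_eq_iff)

lemma degree_ge_if_contains_Berge_star:
  assumes "hypergraph H" and "contains_Berge (star t) H"
  shows "\<exists>v\<in>verts H. t \<le> degree H v"
proof -
  obtain B where "subhypergraph B H" "is_Berge (star t) B"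
    using assms(2) unfolding contains_Berge_def by (elim exE conjE)
  then have B: "verts B \<subseteq> verts H" "edges B \<subseteq> edges H"
    by (simp_all add: subhypergraph_def)
  obtain f \<phi> where f: "f ` verts (star t) \<subseteq> verts B"
    and \<phi>: "bij_betw \<phi> (edges (star t)) (edges B)" "\<forall>e\<in>edges (star t). f ` e \<subseteq> \<phi> e"
    using \<open>is_Berge (star t) B\<close> unfolding is_Berge_def by (elim exE conjE)
  have "card (edges B) = t"
    using bij_betw_same_card[OF bij_betw_trans[OF bij_betw_star_edges \<phi>(1)]] by simp
  moreover have "edges B \<subseteq> {e \<in> edges H. f 0 \<in> e}"
  proof
    fix e assume e: "e \<in> edges B"
    then obtain d where d: "d \<in> edges (star t)" "e = \<phi> d"
      using \<phi>(1) by (auto simp: bij_betw_def)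
    then have "0 \<in> d" by (auto simp: star_def)
    then have "f 0 \<in> e" using d \<phi>(2) by blast
    then show "e \<in> {e \<in> edges H. f 0 \<in> e}" using e B(2) by blast
  qed
  ultimately have "t \<le> degree H (f 0)"
    unfolding degree_def
    using card_mono[of "{e \<in> edges H. f 0 \<in> e}" "edges B"] finite_edges[OF assms(1)] by simp
  moreover have "0 \<in> verts (star t)" by (simp add: star_def)
  then have "f 0 \<in> verts H" using f B(1) by blast
  ultimately show ?thesis by blast
qed

text \<open>
  An edge through the centre \<open>v\<close> serves as the image of a star edge once it is assigned a leaf
  of its own; Hall's theorem provides these leaves.
\<close>

lemma contains_Berge_star_if_degree_ge:
  assumes H: "hypergraph H" "uniform k H" and "k \<ge> 2"
    and v: "v \<in> verts H" "k + 1 \<le> degree H v"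
  shows "contains_Berge (star (k + 1)) H"
proof -
  obtain S where S: "S \<subseteq> {e \<in> edges H. v \<in> e}" "card S = k + 1" "finite S"
    using v(2) unfolding degree_def by (meson obtain_subset_with_card_n)
  have edge: "e \<in> edges H" "v \<in> e" "e \<subseteq> verts H" "card e = k" if "e \<in> S" for e
    using S(1) that H by (auto simp: hypergraph_def uniform_def)
  have finite_edge: "finite e" if "e \<in> S" for e
    using edge(3)[OF that] H(1) by (metis finite_subset hypergraph_def)
  have "\<exists>f. inj_on f S \<and> (\<forall>e\<in>S. f e \<in> e - {v})"
  proof (rule Hall_marriage)
    show "finite S" by fact
    show "finite (e - {v})" if "e \<in> S" for e using finite_edge that by simp
    fix J assume J: "J \<subseteq> S"
    have "inj_on (\<lambda>e. e - {v}) J"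
      using J edge(2) by (intro inj_onI) (metis insert_Diff subset_iff)
    then have card_image: "card ((\<lambda>e. e - {v}) ` J) = card J" by (rule card_image)
    have "card ((\<lambda>e. e - {v}) ` J) \<le> card (\<Union>((\<lambda>e. e - {v}) ` J))"
    proof (rule card_le_card_Union_uniform[where r = "k - 1"])
      show "finite ((\<lambda>e. e - {v}) ` J)" using J S finite_subset by blast
      show "finite T" if "T \<in> (\<lambda>e. e - {v}) ` J" for T
        using that J finite_edge by auto
      show "card T = k - 1" if "T \<in> (\<lambda>e. e - {v}) ` J" for T
        using that J edge by auto
      show "1 \<le> k - 1" using \<open>k \<ge> 2\<close> by simp
      show "card ((\<lambda>e. e - {v}) ` J) \<le> k - 1 + 2"
        using card_image card_mono[OF S(3) J] S(2) by simp
    qed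
    then show "card J \<le> card (\<Union>e\<in>J. e - {v})" using card_image by simp
  qed
  then obtain l where l: "inj_on l S" "\<And>e. e \<in> S \<Longrightarrow> l e \<in> e" "\<And>e. e \<in> S \<Longrightarrow> l e \<noteq> v"
    by blast
  obtain g where g: "bij_betw g {1..k+1} S"
    using S finite_same_card_bij[of "{1..k+1}" S] by auto
  have gS: "g i \<in> S" if "i \<in> {1..k+1}" for i
    using g that by (auto simp: bij_betw_def)
  define f where "f i = (if i = 0 then v else l (g i))" for i :: nat
  define B where "B = \<lparr>verts = verts H, edges = S\<rparr>"
  \<comment> \<open>A star edge \<open>{0, i}\<close> is recognised by its leaf, which is its maximum.\<close>
  define \<phi> where "\<phi> e = g (Max e)" for e
  have "is_Berge (star (k + 1)) B"
    unfolding is_Berge_def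
  proof (intro exI conjI)
    show "inj_on f (verts (star (k + 1)))"
    proof (rule inj_onI)
      fix x y assume xy: "x \<in> verts (star (k + 1))" "y \<in> verts (star (k + 1))" "f x = f y"
      have leaf: "i \<in> {1..k+1}" if "i \<in> verts (star (k + 1))" "i \<noteq> 0" for i
        using that by (simp add: star_def)
      show "x = y"
      proof (cases "x = 0 \<or> y = 0")
        case True
        have "f i \<noteq> v" if "i \<in> verts (star (k + 1))" "i \<noteq> 0" for i
          using l(3)[OF gS[OF leaf[OF that]]] that(2) by (simp add: f_def)
        moreover have "f 0 = v" by (simp add: f_def)
        ultimately show ?thesis
          using True xy by metis
      next
        case False
        then have "g x = g y"
          using xy leaf gS l(1) by (simp add: f_def inj_on_eq_iff)
        then show ?thesis
          using g False leaf xy by (metis bij_betw_imp_inj_on inj_onD)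
      qed
    qed
    show "f ` verts (star (k + 1)) \<subseteq> verts B"
    proof -
      have "f i \<in> verts H" if "i \<in> {0..k+1}" for i
      proof (cases "i = 0")
        case False
        then have "g i \<in> S" using that by (intro gS) simp
        then show ?thesis using False l(2) edge(3) by (auto simp: f_def)
      qed (simp add: f_def v(1))
      then show ?thesis by (auto simp: star_def B_def)
    qed
    have "bij_betw (\<phi> \<circ> (\<lambda>i. {0, i})) {1..k+1} S"
      using g by (simp add: \<phi>_def comp_def)
    then show "bij_betw \<phi> (edges (star (k + 1))) (edges B)"
      using bij_betw_comp_iff[OF bij_betw_star_edges] by (metis B_def hypergraph.select_convs(2))
    show "\<forall>e\<in>edges (star (k + 1)). f ` e \<subseteq> \<phi> e"
      using gS l(2) edge(2) by (auto simp: star_def f_def \<phi>_def)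
  qed
  moreover have "subhypergraph B H"
    using H edge by (auto simp: subhypergraph_def hypergraph_def B_def)
  ultimately show ?thesis unfolding contains_Berge_def by blast
qed

lemma contains_Berge_star_iff:
  assumes "hypergraph H" "uniform k H" "k \<ge> 2"
  shows "contains_Berge (star (k + 1)) H \<longleftrightarrow> (\<exists>v\<in>verts H. k < degree H v)"
proof
  assume "contains_Berge (star (k + 1)) H"
  then show "\<exists>v\<in>verts H. k < degree H v"
    using degree_ge_if_contains_Berge_star[OF assms(1), of "k + 1"] by (simp add: Suc_le_eq)
next
  assume "\<exists>v\<in>verts H. k < degree H v"
  then show "contains_Berge (star (k + 1)) H"
    using contains_Berge_star_if_degree_ge[OF assms] by (auto simp: Suc_le_eq)
qed

lemma degree_add_edge:
  assumes "hypergraph H" "e \<notin> edges H"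
  shows "degree (add_edge H e) v = (if v \<in> e then Suc (degree H v) else degree H v)"
proof -
  have "{d \<in> edges (add_edge H e). v \<in> d} =
      (if v \<in> e then insert e {d \<in> edges H. v \<in> d} else {d \<in> edges H. v \<in> d})"
    by (auto simp: add_edge_def)
  then show ?thesis
    using assms(2) finite_edges[OF assms(1)] by (simp add: degree_def)
qed

lemma Berge_saturated_star_iff:
  fixes H :: "'a hypergraph"
  assumes "k \<ge> 2"
  shows "Berge_saturated k (star (k + 1)) H \<longleftrightarrow>
    hypergraph H \<and> uniform k H \<and> (\<forall>v\<in>verts H. degree H v \<le> k) \<and>
    (\<forall>e. e \<subseteq> verts H \<and> card e = k \<and> e \<notin> edges H \<longrightarrow> (\<exists>v\<in>e. k \<le> degree H v))"
proof -
  have "contains_Berge (star (k + 1)) (add_edge H e) \<longleftrightarrow> (\<exists>v\<in>e. k \<le> degree H v)"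
    if "hypergraph H" "uniform k H" "\<forall>v\<in>verts H. degree H v \<le> k"
      and e: "e \<subseteq> verts H" "card e = k" "e \<notin> edges H" for e
  proof -
    have "hypergraph (add_edge H e)" "uniform k (add_edge H e)"
      using that by (auto simp: hypergraph_def uniform_def add_edge_def)
    then have "contains_Berge (star (k + 1)) (add_edge H e) \<longleftrightarrow>
        (\<exists>v\<in>verts H. k < degree (add_edge H e) v)"
      using contains_Berge_star_iff[of "add_edge H e" k] assms by (simp add: add_edge_def)
    also have "\<dots> \<longleftrightarrow> (\<exists>v\<in>e. k \<le> degree H v)"
    proof -
      have "k < degree (add_edge H e) v \<longleftrightarrow> v \<in> e \<and> k \<le> degree H v" if "v \<in> verts H" for v
        using \<open>\<forall>v\<in>verts H. degree H v \<le> k\<close> that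
        by (auto simp: degree_add_edge[OF \<open>hypergraph H\<close> \<open>e \<notin> edges H\<close>])
      then show ?thesis using e(1) by blast
    qed
    finally show ?thesis .
  qed
  moreover have "\<not> contains_Berge (star (k + 1)) H \<longleftrightarrow> (\<forall>v\<in>verts H. degree H v \<le> k)"
    if "hypergraph H" "uniform k H"
    using contains_Berge_star_iff[OF that assms] by (auto simp: not_less)
  ultimately show ?thesis
    unfolding Berge_saturated_def by blast
qed

section \<open>The lower bound\<close>

lemma sum_degree:
  assumes "hypergraph H" "uniform k H"
  shows "(\<Sum>v\<in>verts H. degree H v) = k * card (edges H)"
  unfolding degree_def
proof (rule sum_multicount)
  show "finite (verts H)" "finite (edges H)"
    using assms finite_edges by (auto simp: hypergraph_def)
  show "\<forall>e\<in>edges H. card {v \<in> verts H. v \<in> e} = k"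
  proof
    fix e assume "e \<in> edges H"
    then have "{v \<in> verts H. v \<in> e} = e" "card e = k"
      using assms by (auto simp: hypergraph_def uniform_def)
    then show "card {v \<in> verts H. v \<in> e} = k" by simp
  qed
qed

text \<open>
  A complete \<open>k\<close>-uniform hypergraph on \<open>k + 1\<close> points is \<open>k\<close>-regular: the edges at \<open>v\<close> are the
  complements of the other points.
\<close>

lemma degree_ge_if_clique:
  assumes "finite (edges H)" "finite T" "card T = k + 1" "v \<in> T"
    and clique: "\<And>e. e \<subseteq> T \<Longrightarrow> card e = k \<Longrightarrow> e \<in> edges H"
  shows "k \<le> degree H v"
proof -
  have "inj_on (\<lambda>u. T - {u}) (T - {v})"
    by (auto simp: inj_on_def)
  then have "card ((\<lambda>u. T - {u}) ` (T - {v})) = k"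
    using assms(2-4) by (simp add: card_image)
  moreover have "T - {u} \<in> edges H" if "u \<in> T" for u
    using assms(2,3) that by (intro clique) auto
  then have "(\<lambda>u. T - {u}) ` (T - {v}) \<subseteq> {e \<in> edges H. v \<in> e}"
    using assms(4) by auto
  ultimately show ?thesis
    unfolding degree_def
    using card_mono[of "{e \<in> edges H. v \<in> e}" "(\<lambda>u. T - {u}) ` (T - {v})"] assms(1) by simp
qed

lemma card_edges_ge_if_Berge_saturated:
  assumes "k \<ge> 2" "k \<le> card (verts H)" and sat: "Berge_saturated k (star (k + 1)) H"
  shows "card (verts H) - k + 1 \<le> card (edges H)"
proof -
  have H: "hypergraph H" "uniform k H"
    using sat by (simp_all add: Berge_saturated_def)
  have edge: "e \<in> edges H" if e: "e \<subseteq> verts H" "card e = k" "\<forall>v\<in>e. degree H v < k" for e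
  proof (rule ccontr)
    assume "e \<notin> edges H"
    then have "\<exists>v\<in>e. k \<le> degree H v"
      using sat e(1,2) unfolding Berge_saturated_star_iff[OF assms(1)] by blast
    then show False using e(3) by (meson leD)
  qed
  have fin: "finite (verts H)" using H by (simp add: hypergraph_def)
  define L where "L = {v \<in> verts H. degree H v < k}"
  have L: "L \<subseteq> verts H" "finite L" using fin by (auto simp: L_def)
  have "card L \<le> k"
  proof (rule ccontr)
    assume "\<not> card L \<le> k"
    then obtain T where T: "T \<subseteq> L" "card T = k + 1" "finite T"
      by (metis Suc_eq_plus1 not_less_eq_eq obtain_subset_with_card_n)
    then have "T \<noteq> {}" by auto
    then obtain v where v: "v \<in> T" by blast
    have "k \<le> degree H v"
    proof (rule degree_ge_if_clique[OF finite_edges[OF H(1)] T(3,2) v])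
      fix e assume "e \<subseteq> T" "card e = k"
      then show "e \<in> edges H" using T(1) by (intro edge) (auto simp: L_def)
    qed
    moreover have "degree H v < k" using v T(1) by (auto simp: L_def)
    ultimately show False by simp
  qed
  have "k * (card (verts H) - k + 1) \<le> k * (card (verts H) - card L) + (\<Sum>v\<in>L. degree H v)"
  proof (cases "card L = k")
    case True
    then have "L \<in> edges H" using L by (intro edge) (auto simp: L_def)
    have "1 \<le> degree H v" if "v \<in> L" for v
    proof -
      have "{e \<in> edges H. v \<in> e} \<noteq> {}" using \<open>L \<in> edges H\<close> that by blast
      then show ?thesis
        using finite_edges[OF H(1)] by (simp add: degree_def Suc_le_eq card_gt_0_iff)
    qed
    then have "k \<le> (\<Sum>v\<in>L. degree H v)"
      using sum_mono[of L "\<lambda>_. 1" "degree H"] True by simp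
    then show ?thesis using True by simp
  next
    case False
    then have "card (verts H) - k + 1 \<le> card (verts H) - card L"
      using \<open>card L \<le> k\<close> assms(2) by linarith
    then show ?thesis by (meson mult_le_mono2 trans_le_add1)
  qed
  also have "\<dots> \<le> (\<Sum>v\<in>verts H - L. degree H v) + (\<Sum>v\<in>L. degree H v)"
  proof -
    have "(\<Sum>v\<in>verts H - L. k) \<le> (\<Sum>v\<in>verts H - L. degree H v)"
      by (rule sum_mono) (auto simp: L_def)
    then show ?thesis
      using L by (simp add: card_Diff_subset mult.commute)
  qed
  also have "\<dots> = k * card (edges H)"
    using sum.subset_diff[OF L(1) fin, of "degree H"] sum_degree[OF H] by simp
  finally show ?thesis using assms(1) by (simp del: mult_Suc_right)
qed

section \<open>Cyclic intervals\<close>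

text \<open>
  The interval of length \<open>k\<close> starting at \<open>i\<close> on the cycle \<open>0, \<dots>, m - 1\<close>. The second
  disjunct is the part that wraps around; splitting it off keeps all conditions linear.
\<close>

definition arc :: "nat \<Rightarrow> nat \<Rightarrow> nat \<Rightarrow> nat set" where
  "arc m k i = {v. v < m \<and> (i \<le> v \<and> v < i + k \<or> v + m < i + k)}"

lemma card_arc:
  assumes "k \<le> m" "i < m"
  shows "card (arc m k i) = k"
proof -
  have "arc m k i = {i..<min m (i + k)} \<union> {..<i + k - m}"
    using assms by (auto simp: arc_def)
  moreover have "{i..<min m (i + k)} \<inter> {..<i + k - m} = {}"
    using assms by auto
  ultimately have "card (arc m k i) = (min m (i + k) - i) + (i + k - m)"
    by (simp add: card_Un_disjoint)
  then show ?thesis using assms by (simp add: min_def)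
qed

lemma card_arcs_through:
  assumes "k \<le> m" "v < m"
  shows "card {i. i < m \<and> v \<in> arc m k i} = k"
proof -
  have "{i. i < m \<and> v \<in> arc m k i} = {v + 1 - k..<v + 1} \<union> {v + m + 1 - k..<m}"
    using assms by (auto simp: arc_def)
  moreover have "{v + 1 - k..<v + 1} \<inter> {v + m + 1 - k..<m} = {}"
    using assms by auto
  ultimately have "card {i. i < m \<and> v \<in> arc m k i} = (v + 1 - (v + 1 - k)) + (m - (v + m + 1 - k))"
    by (simp add: card_Un_disjoint)
  then show ?thesis using assms by linarith
qed

text \<open>
  Equal intervals with distinct starting points \<open>i\<close> and \<open>j\<close> would each contain both points. Going
  from \<open>i\<close> to \<open>j\<close> and on to \<open>i\<close> would then be a full turn in less than \<open>2 * k\<close> steps.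
\<close>

lemma inj_on_arc:
  assumes "1 \<le> k" "2 * k \<le> m"
  shows "inj_on (arc m k) {..<m}"
proof (rule inj_onI)
  fix i j assume ij: "i \<in> {..<m}" "j \<in> {..<m}" "arc m k i = arc m k j"
  have "i \<in> arc m k i" "j \<in> arc m k j" using ij(1,2) assms by (auto simp: arc_def)
  then have "i \<in> arc m k j" "j \<in> arc m k i" using ij(3) by simp_all
  then show "i = j" using ij(1,2) assms by (auto simp: arc_def)
qed

definition cyclic_hypergraph :: "nat \<Rightarrow> nat \<Rightarrow> nat \<Rightarrow> nat hypergraph" where
  "cyclic_hypergraph n m k = \<lparr>verts = {..<n}, edges = arc m k ` {..<m}\<rparr>"

lemma degree_cyclic_hypergraph:
  assumes "1 \<le> k" "2 * k \<le> m"
  shows "degree (cyclic_hypergraph n m k) v = (if v < m then k else 0)"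
proof -
  have "{e \<in> edges (cyclic_hypergraph n m k). v \<in> e} = arc m k ` {i. i < m \<and> v \<in> arc m k i}"
    by (auto simp: cyclic_hypergraph_def)
  moreover have "inj_on (arc m k) {i. i < m \<and> v \<in> arc m k i}"
    using inj_on_arc[OF assms] by (rule inj_on_subset) auto
  ultimately have "degree (cyclic_hypergraph n m k) v = card {i. i < m \<and> v \<in> arc m k i}"
    by (simp add: degree_def card_image)
  also have "\<dots> = (if v < m then k else 0)"
  proof (cases "v < m")
    case True
    then show ?thesis using card_arcs_through[of k m v] assms by simp
  qed (simp add: arc_def)
  finally show ?thesis .
qed

text \<open>
  Only \<open>n - m < k\<close> vertices are isolated, so a new edge must contain a vertex of the cycle, whose
  degree is already \<open>k\<close>.
\<close>

lemma Berge_saturated_cyclic_hypergraph: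
  assumes "2 \<le> k" "2 * k \<le> m" "m \<le> n" "n < m + k"
  shows "Berge_saturated k (star (k + 1)) (cyclic_hypergraph n m k)"
  unfolding Berge_saturated_star_iff[OF assms(1)]
proof (intro conjI allI impI)
  show "hypergraph (cyclic_hypergraph n m k)"
    using assms by (auto simp: hypergraph_def cyclic_hypergraph_def arc_def)
  show "uniform k (cyclic_hypergraph n m k)"
    using assms by (auto simp: uniform_def cyclic_hypergraph_def card_arc)
  show "\<forall>v\<in>verts (cyclic_hypergraph n m k). degree (cyclic_hypergraph n m k) v \<le> k"
    using assms by (simp add: degree_cyclic_hypergraph)
  fix e
  assume e: "e \<subseteq> verts (cyclic_hypergraph n m k) \<and> card e = k \<and> e \<notin> edges (cyclic_hypergraph n m k)"
  have "\<not> e \<subseteq> {m..<n}"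
    using e assms card_mono[of "{m..<n}" e] by auto
  then obtain v where "v \<in> e" "v < m"
    using e by (force simp: cyclic_hypergraph_def)
  then show "\<exists>v\<in>e. k \<le> degree (cyclic_hypergraph n m k) v"
    using assms by (auto simp: degree_cyclic_hypergraph)
qed

section \<open>The saturation number\<close>

theorem theorem5p8:
  fixes k n :: nat
  assumes "k \<ge> 3" and "n \<ge> k\<^sup>2"
  shows "sat k n (star (k + 1)) = enat (n - k + 1)"
proof -
  have "3 * k \<le> n"
    using assms mult_le_mono1[of 3 k k] by (metis le_trans power2_eq_square)
  define m where "m = n - k + 1"
  let ?H = "cyclic_hypergraph n m k"
  have m: "2 * k \<le> m" "m \<le> n" "n < m + k"
    using \<open>3 * k \<le> n\<close> assms(1) by (auto simp: m_def)
  have "Berge_saturated k (star (k + 1)) ?H"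
    using m assms(1) by (intro Berge_saturated_cyclic_hypergraph) auto
  moreover have "card (verts ?H) = n" by (simp add: cyclic_hypergraph_def)
  moreover have "card (edges ?H) = n - k + 1"
    using card_image[OF inj_on_arc[of k m]] m assms(1)
    by (simp add: cyclic_hypergraph_def m_def)
  ultimately have "sat k n (star (k + 1)) \<le> enat (n - k + 1)"
    unfolding sat_def by (intro Inf_lower CollectI exI[of _ ?H]) auto
  moreover have "enat (n - k + 1) \<le> sat k n (star (k + 1))"
    unfolding sat_def
  proof (rule Inf_greatest)
    fix x
    assume "x \<in> {enat (card (edges H)) | H :: nat hypergraph.
              card (verts H) = n \<and> Berge_saturated k (star (k + 1)) H}"
    then obtain H :: "nat hypergraph" where "x = enat (card (edges H))"
      and "card (verts H) = n" "Berge_saturated k (star (k + 1)) H" by blast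
    then show "enat (n - k + 1) \<le> x"
      using card_edges_ge_if_Berge_saturated[of k H] assms(1) \<open>3 * k \<le> n\<close> by simp
  qed
  ultimately show ?thesis by (rule antisym)
qed

end
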